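(* Let $(X,d)$ be a bounded metric space with more than one element, let $M>0$, let $\theta=\frac{\sup d}{M}$, and let $d_E,d_{Em}$ be the associated functions on the set $E$ of finite multisets of $X$. (a) If $\theta\le 1$ (so that $d_E$ and $d_{Em}$ are both metrics on $E$), then $d_E$ and $d_{Em}$ induce the same topology on $E$. (b) If $\theta\le 2$ (so that $d_E$ is a metric on $E$), then the metric $d_E$ is complete if and only if $d$ is complete. If $\theta\le 1$ (so that $d_{Em}$ is a metric on $E$), then the metric $d_{Em}$ is complete if and only if $d$ is complete.
   Context: A (finite) multiset of $X$ is a function $e:X\to\mathbb{N}$ (with $0\in\mathbb{N}$) of finite support; $E$ is the set of all of them. The cardinality of $e$ is $C(e)=\sum_{x\in X}e(x)$. The multiset $e_0$ is the empty multiset (the zero function). Fix $M>0$. For $a,c\in E$ with $C(a)\le C(c)$, list the elements with multiplicity in arbitrary order as $a_1,\dots,a_{C(a)}$ and $c_1,\dots,c_{C(c)}$ (so $\#\{j:a_j=x\}=a(x)$ and $\#\{j:c_j=x\}=c(x)$ for all $x\in X$). Let $G_c$ be the group of permutations of $\{1,\dots,C(c)\}$. Define $$d_E(a,c)=d_E(c,a)=\min_{\gamma\in G_c}\Big(\sum_{j=1}^{C(a)}d(a_j,c_{\gamma(j)})+M\,|C(c)-C(a)|\Big),$$ $$d_{Em}(a,c)=\frac{d_E(a,c)}{\max(C(a),C(c))},$$ with $d_E(e_0,e_0)=d_{Em}(e_0,e_0)=0$. Here $\sup d$ denotes $\sup_{x,y\in X}d(x,y)$. *)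

theory Defs
  imports "HOL-Analysis.Analysis" "HOL-Combinatorics.Permutations"
begin

definition finite_multisets :: "'a set \<Rightarrow> 'a multiset set" where
  "finite_multisets X = {e. set_mset e \<subseteq> X}"

definition sup_dist :: "'a set \<Rightarrow> ('a \<Rightarrow> 'a \<Rightarrow> real) \<Rightarrow> real" where
  "sup_dist X d = (SUP (x, y) \<in> X \<times> X. d x y)"

text \<open>Enumerations are lists, with positions counted from \<open>0\<close>. The formula is meant for
  \<open>length as \<le> length cs\<close>.\<close>

definition list_dist :: "('a \<Rightarrow> 'a \<Rightarrow> real) \<Rightarrow> real \<Rightarrow> 'a list \<Rightarrow> 'a list \<Rightarrow> real" where
  "list_dist d M as cs =
     Min ((\<lambda>\<gamma>. (\<Sum>j<length as. d (as ! j) (cs ! \<gamma> j)) + M * \<bar>real (length cs) - real (length as)\<bar>)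
            ` {\<gamma>. \<gamma> permutes {..<length cs}})"

text \<open>The enumerations are chosen arbitrarily; \<open>d_E_eq_list_dist\<close> below shows that the choice
  is irrelevant, and \<open>d_E_commute\<close> that the orientation is irrelevant for equal cardinalities.\<close>

definition d_E :: "('a \<Rightarrow> 'a \<Rightarrow> real) \<Rightarrow> real \<Rightarrow> 'a multiset \<Rightarrow> 'a multiset \<Rightarrow> real" where
  "d_E d M a c =
     (let as = (SOME as. mset as = a); cs = (SOME cs. mset cs = c)
      in if size a \<le> size c then list_dist d M as cs else list_dist d M cs as)"

text \<open>The value at a pair of empty multisets is \<open>0\<close>, because \<open>0 / 0 = 0\<close>.\<close>

definition d_Em :: "('a \<Rightarrow> 'a \<Rightarrow> real) \<Rightarrow> real \<Rightarrow> 'a multiset \<Rightarrow> 'a multiset \<Rightarrow> real" where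
  "d_Em d M a c = d_E d M a c / real (max (size a) (size c))"

lemma list_dist_mset_cong:
  assumes "mset as = mset as'" "mset cs = mset cs'" "length as \<le> length cs"
  shows "list_dist d M as cs = list_dist d M as' cs'"
proof -
  define F where "F = (\<lambda>(as :: 'a list) (cs :: 'a list).
    (\<lambda>\<gamma>. (\<Sum>j<length as. d (as ! j) (cs ! \<gamma> j)) + M * \<bar>real (length cs) - real (length as)\<bar>)
            ` {\<gamma>. \<gamma> permutes {..<length cs}})"
  have sub: "F as' cs' \<subseteq> F as cs"
    if m: "mset as = mset as'" "mset cs = mset cs'" "length as \<le> length cs"
    for as as' cs cs' :: "'a list"
  proof
    fix v assume "v \<in> F as' cs'"
    have la: "length as' = length as" and lc: "length cs' = length cs"
      using m by (metis size_mset)+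
    obtain p where p: "p permutes {..<length as}" "permute_list p as = as'"
      using mset_eq_permutation[of as' as] m(1) by metis
    obtain q where q: "q permutes {..<length cs}" "permute_list q cs = cs'"
      using mset_eq_permutation[of cs' cs] m(2) by metis
    from \<open>v \<in> F as' cs'\<close> obtain \<gamma> where g: "\<gamma> permutes {..<length cs}"
      and v: "v = (\<Sum>j<length as. d (as' ! j) (cs' ! \<gamma> j)) + M * \<bar>real (length cs) - real (length as)\<bar>"
      unfolding F_def using la lc by auto
    define h where "h = q \<circ> \<gamma> \<circ> inv p"
    have ip: "inv p permutes {..<length cs}"
      using permutes_subset[OF permutes_inv[OF p(1)]] m(3) by auto
    have h: "h permutes {..<length cs}"
      unfolding h_def by (intro permutes_compose ip g q(1))
    have "(\<Sum>j<length as. d (as' ! j) (cs' ! \<gamma> j)) = (\<Sum>j<length as. d (as ! p j) (cs ! h (p j)))"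
    proof (rule sum.cong[OF refl])
      fix j assume j: "j \<in> {..<length as}"
      then have "\<gamma> j < length cs"
        using permutes_in_image[OF g, of j] m(3) by auto
      then have "cs' ! \<gamma> j = cs ! q (\<gamma> j)"
        using permute_list_nth[OF q(1)] q(2) by auto
      moreover have "as' ! j = as ! p j"
        using permute_list_nth[OF p(1)] p(2) j by auto
      ultimately show "d (as' ! j) (cs' ! \<gamma> j) = d (as ! p j) (cs ! h (p j))"
        by (simp add: h_def permutes_inverses[OF p(1)])
    qed
    also have "\<dots> = (\<Sum>j<length as. d (as ! j) (cs ! h j))"
      using sum.permute[OF p(1), of "\<lambda>j. d (as ! j) (cs ! h j)"] by (simp add: o_def)
    finally show "v \<in> F as cs"
      unfolding F_def v using h by auto
  qed
  have "length as' \<le> length cs'"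
    using assms by (metis size_mset)
  then have "F as cs = F as' cs'"
    using sub[of as as' cs cs'] sub[of as' as cs' cs] assms by auto
  then show ?thesis
    by (simp add: list_dist_def F_def)
qed

lemma list_dist_commute:
  assumes "\<And>x y. d x y = d y x" "length as = length cs"
  shows "list_dist d M as cs = list_dist d M cs as"
proof -
  have *: "(\<Sum>j<length as. d (as ! j) (cs ! \<gamma> j)) = (\<Sum>j<length as. d (cs ! j) (as ! inv \<gamma> j))"
    if "\<gamma> permutes {..<length as}" for \<gamma>
    using sum.permute[OF that, of "\<lambda>j. d (cs ! j) (as ! inv \<gamma> j)"] assms(1)
    by (simp add: o_def permutes_inverses[OF that])
  have inv_image: "{\<gamma>. \<gamma> permutes {..<length as}} = inv ` {\<gamma>. \<gamma> permutes {..<length as}}"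
  proof (intro set_eqI iffI)
    fix \<gamma> :: "nat \<Rightarrow> nat"
    assume "\<gamma> \<in> {\<gamma>. \<gamma> permutes {..<length as}}"
    then have "\<gamma> = inv (inv \<gamma>)" "inv \<gamma> permutes {..<length as}"
      by (simp_all add: permutes_inv permutes_inv_inv)
    then show "\<gamma> \<in> inv ` {\<gamma>. \<gamma> permutes {..<length as}}"
      by blast
  next
    fix \<gamma> :: "nat \<Rightarrow> nat"
    assume "\<gamma> \<in> inv ` {\<gamma>. \<gamma> permutes {..<length as}}"
    then show "\<gamma> \<in> {\<gamma>. \<gamma> permutes {..<length as}}"
      by (auto simp: permutes_inv)
  qed
  have "list_dist d M cs as =
      Min ((\<lambda>\<gamma>. (\<Sum>j<length as. d (cs ! j) (as ! inv \<gamma> j)) + M * \<bar>real (length as) - real (length cs)\<bar>)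
            ` {\<gamma>. \<gamma> permutes {..<length as}})"
    using arg_cong[OF inv_image, of "\<lambda>S. Min ((\<lambda>\<gamma>. (\<Sum>j<length as. d (cs ! j) (as ! \<gamma> j))
      + M * \<bar>real (length as) - real (length cs)\<bar>) ` S)", unfolded image_image]
    unfolding list_dist_def assms(2)[symmetric] .
  also have "\<dots> = list_dist d M as cs"
    unfolding list_dist_def assms(2)[symmetric] by (intro arg_cong[of _ _ Min] image_cong) (auto simp: *)
  finally show ?thesis ..
qed

lemma some_mset: "mset (SOME xs. mset xs = a) = a"
  by (rule someI_ex) (rule ex_mset)

lemma d_E_eq_list_dist:
  assumes "mset as = a" "mset cs = c" "size a \<le> size c"
  shows "d_E d M a c = list_dist d M as cs"
proof -
  have "length (SOME as. mset as = a) \<le> length (SOME cs. mset cs = c)"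
    using assms(3) by (metis size_mset some_mset)
  then show ?thesis
    using assms list_dist_mset_cong[of "SOME as. mset as = a" as "SOME cs. mset cs = c" cs]
    by (simp add: d_E_def some_mset)
qed

lemma d_E_commute:
  assumes "\<And>x y. d x y = d y x"
  shows "d_E d M a c = d_E d M c a"
proof (cases "size a = size c")
  case True
  then have "length (SOME as. mset as = a) = length (SOME cs. mset cs = c)"
    by (metis size_mset some_mset)
  then show ?thesis
    using True assms by (simp add: d_E_def list_dist_commute)
qed (auto simp: d_E_def Let_def)

lemma d_E_empty: "d_E d M {#} {#} = 0" "d_Em d M {#} {#} = 0"
proof -
  show "d_E d M {#} {#} = 0"
    by (simp add: d_E_eq_list_dist[of "[]" _ "[]"] list_dist_def)
  then show "d_Em d M {#} {#} = 0"
    by (simp add: d_Em_def)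
qed

end

theory Submission
  imports Defs
begin

text \<open>If \<open>d \<le> 2M\<close>, then \<open>d_E\<close> is the least cost of a partial matching in which a matched pair
  costs its distance and an unmatched point costs \<open>M\<close>, since matching two unmatched points never
  raises the cost. Partial matchings compose, which gives the triangle inequality.
  For \<open>d_Em\<close> the only hard case is an intermediate multiset \<open>b\<close> larger than both ends: if
  \<open>d \<le> M\<close>, deleting a surplus point of \<open>b\<close> lowers the total cost of the two matchings by at least
  \<open>M\<close>. A \<open>d_Em\<close>-ball of radius \<open>M/2\<close> contains only multisets of bounded size, so \<open>d_E\<close> and \<open>d_Em\<close>
  have the same open sets and the same Cauchy sequences. Finally, a rapidly Cauchy sequence for \<open>d_E\<close>
  has constant size and can be enumerated so that every coordinate is Cauchy for \<open>d\<close>; conversely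
  \<open>x \<mapsto> {#x#}\<close> is an isometry, and limits of singletons are singletons.\<close>

section \<open>Partial matchings and their costs\<close>

locale matching_cost = Metric_space X d
  for X :: "'a set" and d :: "'a \<Rightarrow> 'a \<Rightarrow> real" +
  fixes M :: real
  assumes M_pos: "M > 0"
begin

inductive matches :: "'a multiset \<Rightarrow> 'a multiset \<Rightarrow> real \<Rightarrow> bool" where
  empty: "matches {#} {#} 0"
| pair: "matches a c r \<Longrightarrow> matches (add_mset x a) (add_mset y c) (d x y + r)"
| left: "matches a c r \<Longrightarrow> matches (add_mset x a) c (M + r)"
| right: "matches a c r \<Longrightarrow> matches a (add_mset y c) (M + r)"

lemma matches_commute: "matches a c r \<Longrightarrow> matches c a r"
  by (induction rule: matches.induct) (metis matches.intros commute)+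

lemma matches_refl:
  assumes "set_mset a \<subseteq> X"
  shows "matches a a 0"
  using assms
proof (induction a)
  case (add x a)
  then have "matches (add_mset x a) (add_mset x a) (d x x + 0)"
    by (intro matches.pair) auto
  with add show ?case by simp
qed (rule matches.empty)

lemma matches_nonneg: "matches a c r \<Longrightarrow> 0 \<le> r"
proof (induction rule: matches.induct)
  case (pair a c r x y)
  then show ?case using nonneg[of x y] by linarith
qed (use M_pos in auto)

text \<open>An unmatched point costs \<open>M > 0\<close>, so at cost zero every point is paired,
  and at distance zero, hence with a copy of itself.\<close>

lemma matches_zero:
  "matches a c r \<Longrightarrow> r = 0 \<Longrightarrow> set_mset a \<subseteq> X \<Longrightarrow> set_mset c \<subseteq> X \<Longrightarrow> a = c"
proof (induction rule: matches.induct)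
  case (pair a c r x y)
  then have "d x y = 0" "r = 0"
    using nonneg[of x y] matches_nonneg[of a c r] by linarith+
  with pair show ?case by auto
next
  case (left a c r x)
  then show ?case using M_pos matches_nonneg[of a c r] by linarith
next
  case (right a c r y)
  then show ?case using M_pos matches_nonneg[of a c r] by linarith
qed simp

text \<open>Pairs leave the size difference alone; each unmatched point changes it by at most one
  and pays \<open>M\<close>.\<close>

lemma matches_size:
  "matches a c r \<Longrightarrow> M * \<bar>real (size a) - real (size c)\<bar> \<le> r"
proof (induction rule: matches.induct)
  case (pair a c r x y)
  have "real (size (add_mset x a)) - real (size (add_mset y c)) = real (size a) - real (size c)"
    by simp
  then show ?case
    using add_increasing[OF nonneg[of x y] pair.IH] by (simp only:)
next
  case (left a c r x)
  have "\<bar>real (size (add_mset x a)) - real (size c)\<bar> \<le> 1 + \<bar>real (size a) - real (size c)\<bar>"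
    by simp
  then have "M * \<bar>real (size (add_mset x a)) - real (size c)\<bar> \<le> M * (1 + \<bar>real (size a) - real (size c)\<bar>)"
    using M_pos by (intro mult_left_mono) auto
  with left show ?case by (simp add: distrib_left)
next
  case (right a c r y)
  have "\<bar>real (size a) - real (size (add_mset y c))\<bar> \<le> 1 + \<bar>real (size a) - real (size c)\<bar>"
    by simp
  then have "M * \<bar>real (size a) - real (size (add_mset y c))\<bar> \<le> M * (1 + \<bar>real (size a) - real (size c)\<bar>)"
    using M_pos by (intro mult_left_mono) auto
  with right show ?case by (simp add: distrib_left)
qed simp

text \<open>A derivation may have added \<open>y\<close> at any stage. The induction moves that
  stage to the end, so that \<open>y\<close> can be peeled off either with its partner
  \<open>z\<close> or as an unmatched point.\<close>

lemma matches_remove: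
  "matches a' c s \<Longrightarrow> a' = add_mset y a \<Longrightarrow>
    (\<exists>z c' s'. c = add_mset z c' \<and> matches a c' s' \<and> s = d y z + s') \<or>
    (\<exists>s'. matches a c s' \<and> s = M + s')"
proof (induction arbitrary: a rule: matches.induct)
  case (pair a0 c r x z)
  show ?case
  proof (cases "x = y")
    case True
    then have "a0 = a" using pair.prems by simp
    then show ?thesis using pair.hyps True by blast
  next
    case False
    with pair.prems obtain K where K: "a0 = add_mset y K" "a = add_mset x K"
      by (auto simp: add_eq_conv_ex)
    from pair.IH[OF K(1)] show ?thesis
    proof (elim disjE exE conjE)
      fix w c' s' assume "c = add_mset w c'" "matches K c' s'" "r = d y w + s'"
      then show ?thesis
        using matches.pair[of K c' s' x z] K(2)
        by (intro disjI1 exI[of _ w] exI[of _ "add_mset z c'"] exI[of _ "d x z + s'"]) auto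
    next
      fix s' assume "matches K c s'" "r = M + s'"
      then show ?thesis
        using matches.pair[of K c s' x z] K(2)
        by (intro disjI2 exI[of _ "d x z + s'"]) auto
    qed
  qed
next
  case (left a0 c r x)
  show ?case
  proof (cases "x = y")
    case True
    then have "a0 = a" using left.prems by simp
    then show ?thesis using left.hyps True by blast
  next
    case False
    with left.prems obtain K where K: "a0 = add_mset y K" "a = add_mset x K"
      by (auto simp: add_eq_conv_ex)
    from left.IH[OF K(1)] show ?thesis
    proof (elim disjE exE conjE)
      fix w c' s' assume "c = add_mset w c'" "matches K c' s'" "r = d y w + s'"
      then show ?thesis
        using matches.left[of K c' s' x] K(2)
        by (intro disjI1 exI[of _ w] exI[of _ c'] exI[of _ "M + s'"]) auto
    next
      fix s' assume "matches K c s'" "r = M + s'"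
      then show ?thesis
        using matches.left[of K c s' x] K(2)
        by (intro disjI2 exI[of _ "M + s'"]) auto
    qed
  qed
next
  case (right a0 c r z)
  from right.IH[OF right.prems] show ?case
  proof (elim disjE exE conjE)
    fix w c' s' assume "c = add_mset w c'" "matches a c' s'" "r = d y w + s'"
    then show ?thesis
      using matches.right[of a c' s' z]
      by (intro disjI1 exI[of _ w] exI[of _ "add_mset z c'"] exI[of _ "M + s'"]) auto
  next
    fix s' assume "matches a c s'" "r = M + s'"
    then show ?thesis
      using matches.right[of a c s' z]
      by (intro disjI2 exI[of _ "M + s'"]) auto
  qed
qed simp

text \<open>Composition through \<open>b\<close>: the pairs \<open>x\<close>-\<open>y\<close> and
  \<open>y\<close>-\<open>z\<close> become \<open>x\<close>-\<open>z\<close> by the triangle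
  inequality for \<open>d\<close>. If \<open>y\<close> is unmatched on one side, its partner on the
  other side becomes unmatched and inherits the payment \<open>M\<close>; if on both sides, both
  payments disappear.\<close>

lemma matches_trans:
  assumes "matches a b r" "matches b c s"
    and "set_mset a \<subseteq> X" "set_mset b \<subseteq> X" "set_mset c \<subseteq> X"
  shows "\<exists>t\<le>r + s. matches a c t"
  using assms
proof (induction arbitrary: c s rule: matches.induct)
  case (pair a b r x y)
  from matches_remove[OF pair.prems(1) refl] show ?case
  proof (elim disjE exE conjE)
    fix z c' s' assume h: "c = add_mset z c'" "matches b c' s'" "s = d y z + s'"
    with pair obtain t where "t \<le> r + s'" "matches a c' t" by force
    moreover have "d x z \<le> d x y + d y z"
      using pair.prems h by (intro triangle) auto
    ultimately show ?thesis
      using h matches.pair[of a c' t x z] by (intro exI[of _ "d x z + t"]) auto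
  next
    fix s' assume h: "matches b c s'" "s = M + s'"
    with pair obtain t where "t \<le> r + s'" "matches a c t" by force
    moreover from this have "M + t \<le> d x y + r + s"
      using h nonneg[of x y] by linarith
    ultimately show ?thesis
      using matches.left[of a c t x] by blast
  qed
next
  case (left a b r x)
  then obtain t where "t \<le> r + s" "matches a c t" by force
  then show ?case
    using matches.left[of a c t x] by (intro exI[of _ "M + t"]) auto
next
  case (right a b r y)
  from matches_remove[OF right.prems(1) refl] show ?case
  proof (elim disjE exE conjE)
    fix z c' s' assume h: "c = add_mset z c'" "matches b c' s'" "s = d y z + s'"
    with right obtain t where "t \<le> r + s'" "matches a c' t" by force
    moreover from this have "M + t \<le> M + r + s"
      using h nonneg[of y z] by linarith
    ultimately show ?thesis
      using h matches.right[of a c' t z] by blast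
  next
    fix s' assume h: "matches b c s'" "s = M + s'"
    with right obtain t where "t \<le> r + s'" "matches a c t" by force
    then show ?thesis
      using h M_pos by (intro exI[of _ t]) auto
  qed
qed auto

text \<open>Pairs use equally many points of both sides, so the larger side has an unmatched point,
  which can be deleted together with its cost.\<close>

lemma matches_excess:
  assumes "matches a b s" "size a < size b"
  shows "\<exists>z b' s'. b = add_mset z b' \<and> matches a b' s' \<and> s = M + s'"
  using assms
proof (induction rule: matches.induct)
  case (pair a c r x y)
  then obtain z b' s' where "c = add_mset z b'" "matches a b' s'" "r = M + s'" by auto
  then show ?case
    using matches.pair[of a b' s' x y]
    by (intro exI[of _ z] exI[of _ "add_mset y b'"] exI[of _ "d x y + s'"]) auto
next
  case (left a c r x)
  then obtain z b' s' where "c = add_mset z b'" "matches a b' s'" "r = M + s'" by auto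
  then show ?case
    using matches.left[of a b' s' x]
    by (intro exI[of _ z] exI[of _ b'] exI[of _ "M + s'"]) auto
qed auto

section \<open>Optimal enumerations and least matching costs\<close>

lemma matches_lists:
  assumes "length as \<le> length cs"
  shows "matches (mset as) (mset cs)
    ((\<Sum>j<length as. d (as ! j) (cs ! j)) + M * \<bar>real (length cs) - real (length as)\<bar>)"
  using assms
proof (induction as arbitrary: cs)
  case Nil
  show ?case
  proof (induction cs)
    case (Cons y cs)
    from matches.right[OF this, of y] show ?case by (simp add: algebra_simps)
  qed (simp add: matches.empty)
next
  case (Cons x as)
  then obtain y cs' where cs: "cs = y # cs'" by (cases cs) auto
  with Cons have "matches (mset as) (mset cs')
    ((\<Sum>j<length as. d (as ! j) (cs' ! j)) + M * \<bar>real (length cs') - real (length as)\<bar>)"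
    by auto
  from matches.pair[OF this, of x y] show ?case
    unfolding cs by (simp add: sum.lessThan_Suc_shift add.assoc del: sum.lessThan_Suc)
qed

text \<open>The minimising permutation is absorbed into the enumeration of the larger multiset,
  after which the optimal matching pairs equal positions.\<close>

lemma list_dist_attained:
  assumes "length as \<le> length cs"
  obtains cs' where "mset cs' = mset cs"
    "list_dist d M as cs =
      (\<Sum>j<length as. d (as ! j) (cs' ! j)) + M * \<bar>real (length cs) - real (length as)\<bar>"
proof -
  let ?S = "{\<gamma>. \<gamma> permutes {..<length cs}}"
  have "finite ?S" "id \<in> ?S"
    by (simp_all add: finite_permutations permutes_id)
  then have "list_dist d M as cs \<in> (\<lambda>\<gamma>. (\<Sum>j<length as. d (as ! j) (cs ! \<gamma> j)) +
      M * \<bar>real (length cs) - real (length as)\<bar>) ` ?S"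
    unfolding list_dist_def by (intro Min_in) blast+
  then obtain \<gamma> where g: "\<gamma> permutes {..<length cs}" and
    eq: "list_dist d M as cs = (\<Sum>j<length as. d (as ! j) (cs ! \<gamma> j)) +
      M * \<bar>real (length cs) - real (length as)\<bar>" by auto
  show thesis
  proof (rule that[of "permute_list \<gamma> cs"])
    show "mset (permute_list \<gamma> cs) = mset cs" using g by simp
    show "list_dist d M as cs = (\<Sum>j<length as. d (as ! j) (permute_list \<gamma> cs ! j)) +
      M * \<bar>real (length cs) - real (length as)\<bar>"
      unfolding eq using assms by (auto intro!: sum.cong simp: permute_list_nth[OF g])
  qed
qed

lemma list_dist_le:
  "list_dist d M as cs \<le>
    (\<Sum>j<length as. d (as ! j) (cs ! j)) + M * \<bar>real (length cs) - real (length as)\<bar>"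
  unfolding list_dist_def
proof (rule Min_le)
  show "(\<Sum>j<length as. d (as ! j) (cs ! j)) + M * \<bar>real (length cs) - real (length as)\<bar> \<in>
    (\<lambda>\<gamma>. (\<Sum>j<length as. d (as ! j) (cs ! \<gamma> j)) + M * \<bar>real (length cs) - real (length as)\<bar>)
      ` {\<gamma>. \<gamma> permutes {..<length cs}}"
    by (rule image_eqI[of _ _ id]) (simp_all add: permutes_id)
qed (simp add: finite_permutations)

text \<open>The enumeration \<open>as\<close> is prescribed and only that of \<open>c\<close> adapts
  to it. This freedom allows enumerations to be aligned one after another along a sequence.\<close>

lemma d_E_enumeration:
  assumes "mset as = a" "size a \<le> size c"
  obtains cs where "mset cs = c"
    "d_E d M a c = (\<Sum>j<length as. d (as ! j) (cs ! j)) + M * (real (size c) - real (size a))"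
proof -
  obtain cs where cs: "mset cs = c" using ex_mset by blast
  have l: "length as = size a" "length cs = size c"
    using assms cs by (metis size_mset)+
  obtain cs' where "mset cs' = mset cs"
    "list_dist d M as cs =
      (\<Sum>j<length as. d (as ! j) (cs' ! j)) + M * \<bar>real (length cs) - real (length as)\<bar>"
    using list_dist_attained[of as cs] l assms(2) by metis
  then show thesis
    using d_E_eq_list_dist[OF assms(1) cs assms(2), of d M] l cs assms(2) that[of cs'] by auto
qed

text \<open>Since \<open>d_E\<close> is itself a matching cost, lower bounds on matching costs apply
  to it, and optimal matchings can be composed.\<close>

lemma matches_d_E: "matches a c (d_E d M a c)"
proof -
  have *: "matches a c (d_E d M a c)" if le: "size a \<le> size c" for a c
  proof -
    obtain as where as: "mset as = a" using ex_mset by blast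
    obtain cs where cs: "mset cs = c"
      "d_E d M a c = (\<Sum>j<length as. d (as ! j) (cs ! j)) + M * (real (size c) - real (size a))"
      using d_E_enumeration[OF as le] by metis
    have l: "length as = size a" "length cs = size c"
      using as cs by (metis size_mset)+
    then show ?thesis
      using matches_lists[of as cs] le as cs by auto
  qed
  show ?thesis
  proof (cases "size a \<le> size c")
    case False
    then have "matches c a (d_E d M c a)" by (intro *) auto
    then show ?thesis
      using matches_commute d_E_commute[of d M a c] commute by metis
  qed (rule *)
qed

text \<open>As long as both sides have unmatched points, pairing one of each replaces
  \<open>2 * M\<close> by a distance of at most \<open>2 * M\<close>. In the end at most one side
  has unmatched points, and the matching comes from enumerations.\<close>

lemma d_E_le_partial_matching:
  assumes "set_mset (image_mset fst S + u) \<subseteq> X" "set_mset (image_mset snd S + v) \<subseteq> X"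
    and diam: "\<And>x y. x \<in> X \<Longrightarrow> y \<in> X \<Longrightarrow> d x y \<le> 2 * M"
  shows "d_E d M (image_mset fst S + u) (image_mset snd S + v) \<le>
    (\<Sum>(x, y)\<in>#S. d x y) + M * (real (size u) + real (size v))"
proof -
  \<comment> \<open>With the first multiset fully matched, listing the pairs first and the points of
    \<open>v\<close> last makes the identity permutation realise this matching.\<close>
  have base: "d_E d M (image_mset fst S) (image_mset snd S + v) \<le>
    (\<Sum>(x, y)\<in>#S. d x y) + M * real (size v)" for S v
  proof -
    obtain ps where ps: "mset ps = S" using ex_mset by blast
    obtain vs where vs: "mset vs = v" using ex_mset by blast
    have "d_E d M (image_mset fst S) (image_mset snd S + v) =
      list_dist d M (map fst ps) (map snd ps @ vs)"
      using ps vs by (intro d_E_eq_list_dist) auto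
    also have "\<dots> \<le> (\<Sum>j<length ps. d (fst (ps ! j)) (snd (ps ! j))) + M * real (length vs)"
      using list_dist_le[of "map fst ps" "map snd ps @ vs"]
      by (simp add: nth_append)
    also have "(\<Sum>j<length ps. d (fst (ps ! j)) (snd (ps ! j))) = (\<Sum>(x, y)\<in>#S. d x y)"
      unfolding ps[symmetric]
      by (simp add: sum_mset_sum_list sum_list_sum_nth atLeast0LessThan split_def flip: mset_map)
    finally show ?thesis using vs by auto
  qed
  show ?thesis
    using assms(1,2)
  proof (induction u arbitrary: S v)
    case empty
    show ?case using base[of S v] by simp
  next
    case (add x u)
    show ?case
    proof (cases v)
      case empty
      \<comment> \<open>Unmatched points remain only on the first side; exchanging the components of
        every pair reduces this to \<open>base\<close>.\<close>
      let ?T = "image_mset prod.swap S"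
      have "d_E d M (image_mset fst ?T) (image_mset snd ?T + add_mset x u) \<le>
        (\<Sum>(x, y)\<in>#?T. d x y) + M * real (size (add_mset x u))"
        by (rule base)
      moreover have "image_mset fst ?T = image_mset snd S" "image_mset snd ?T = image_mset fst S"
        "(\<Sum>(x, y)\<in>#?T. d x y) = (\<Sum>(x, y)\<in>#S. d x y)"
        by (simp_all add: multiset.map_comp o_def split_def commute)
      ultimately show ?thesis
        using empty d_E_commute[of d M "image_mset snd S" "image_mset fst S + add_mset x u"] commute
        by auto
    next
      case (add y v')
      have "d x y \<le> 2 * M"
        using add.prems add by (intro diam) auto
      moreover have "d_E d M (image_mset fst (add_mset (x, y) S) + u)
          (image_mset snd (add_mset (x, y) S) + v') \<le>
        (\<Sum>(x, y)\<in>#add_mset (x, y) S. d x y) + M * (real (size u) + real (size v'))"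
        using add.prems add by (intro add.IH) auto
      ultimately show ?thesis
        using add by (simp add: algebra_simps)
    qed
  qed
qed

text \<open>\<open>S\<close> collects the pairs, \<open>u\<close> and \<open>v\<close> the unmatched
  points of the two sides; this is the form that \<open>d_E_le_partial_matching\<close>
  takes.\<close>

lemma matches_decompose:
  "matches a c r \<Longrightarrow> \<exists>S u v. a = image_mset fst S + u \<and> c = image_mset snd S + v \<and>
    r = (\<Sum>(x, y)\<in>#S. d x y) + M * (real (size u) + real (size v))"
proof (induction rule: matches.induct)
  case (pair a c r x y)
  then obtain S u v where "a = image_mset fst S + u" "c = image_mset snd S + v"
    "r = (\<Sum>(x, y)\<in>#S. d x y) + M * (real (size u) + real (size v))" by blast
  then show ?case
    by (intro exI[of _ "add_mset (x, y) S"] exI[of _ u] exI[of _ v]) auto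
next
  case (left a c r x)
  then obtain S u v where "a = image_mset fst S + u" "c = image_mset snd S + v"
    "r = (\<Sum>(x, y)\<in>#S. d x y) + M * (real (size u) + real (size v))" by blast
  then show ?case
    by (intro exI[of _ S] exI[of _ "add_mset x u"] exI[of _ v]) (auto simp: algebra_simps)
next
  case (right a c r y)
  then obtain S u v where "a = image_mset fst S + u" "c = image_mset snd S + v"
    "r = (\<Sum>(x, y)\<in>#S. d x y) + M * (real (size u) + real (size v))" by blast
  then show ?case
    by (intro exI[of _ S] exI[of _ u] exI[of _ "add_mset y v"]) (auto simp: algebra_simps)
next
  case empty
  show ?case by (intro exI[of _ "{#}"]) simp
qed

lemma d_E_le:
  assumes "\<And>x y. x \<in> X \<Longrightarrow> y \<in> X \<Longrightarrow> d x y \<le> 2 * M"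
    and "matches a c r" "set_mset a \<subseteq> X" "set_mset c \<subseteq> X"
  shows "d_E d M a c \<le> r"
  using matches_decompose[OF assms(2)] d_E_le_partial_matching assms by blast

lemma d_E_nonneg: "0 \<le> d_E d M a c"
  using matches_d_E matches_nonneg by blast

lemma d_E_size: "M * \<bar>real (size a) - real (size c)\<bar> \<le> d_E d M a c"
  using matches_d_E matches_size by blast

section \<open>The metric axioms for \<open>d_E\<close>\<close>

lemma Metric_space_d_E:
  assumes diam: "\<And>x y. x \<in> X \<Longrightarrow> y \<in> X \<Longrightarrow> d x y \<le> 2 * M"
  shows "Metric_space (finite_multisets X) (d_E d M)"
proof
  show "0 \<le> d_E d M a c" for a c by (rule d_E_nonneg)
  show "d_E d M a c = d_E d M c a" for a c by (rule d_E_commute) (rule commute)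
  show "d_E d M a c = 0 \<longleftrightarrow> a = c" if "a \<in> finite_multisets X" "c \<in> finite_multisets X" for a c
    using that matches_zero[OF matches_d_E] d_E_le[OF diam matches_refl] d_E_nonneg[of a c]
    by (auto simp: finite_multisets_def intro: antisym)
  show "d_E d M a c \<le> d_E d M a b + d_E d M b c"
    if "a \<in> finite_multisets X" "b \<in> finite_multisets X" "c \<in> finite_multisets X" for a b c
    using that matches_trans[OF matches_d_E matches_d_E, of a b c] d_E_le[OF diam, of a c]
    by (force simp: finite_multisets_def)
qed


section \<open>Deleting surplus points of an intermediate multiset\<close>

lemma matches_shrink:
  assumes diam: "\<And>x y. x \<in> X \<Longrightarrow> y \<in> X \<Longrightarrow> d x y \<le> M"
    and "matches a (add_mset y b) r" "size a \<le> size b" "set_mset a \<subseteq> X" "set_mset b \<subseteq> X"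
  shows "\<exists>t\<le>r. matches a b t"
  using matches_remove[OF matches_commute[OF assms(2)] refl]
proof (elim disjE exE conjE)
  fix x a' s' assume a: "a = add_mset x a'" and m: "matches b a' s'" and r: "r = d y x + s'"
  \<comment> \<open>The partner \<open>x\<close> of the deleted \<open>y\<close> needs a new
    partner. By counting, some \<open>z\<close> in \<open>b\<close> is unmatched, and its payment
    \<open>M\<close> covers \<open>d x z\<close>.\<close>
  have "size a' < size b" using a assms(3) by simp
  then obtain z b' s'' where b: "b = add_mset z b'" "matches a' b' s''" "s' = M + s''"
    using matches_excess[OF matches_commute[OF m]] by blast
  have "d x z \<le> M" using assms(4,5) a b by (intro diam) auto
  then have "d x z + s'' \<le> r" using b r nonneg[of y x] by linarith
  then show ?thesis using matches.pair[OF b(2), of x z] a b by blast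
next
  fix s' assume "matches b a s'" "r = M + s'"
  then show ?thesis using M_pos by (intro exI[of _ s']) (auto intro: matches_commute)
qed

text \<open>The matching with \<open>c\<close> leaves a point of \<open>b\<close> unmatched;
  deleting it saves \<open>M\<close> there and, by \<open>matches_shrink\<close>, costs nothing in
  the matching with \<open>a\<close>. After \<open>n\<close> deletions \<open>b\<close> is as large
  as \<open>c\<close> and the matchings are composed.\<close>

lemma matches_trans_surplus:
  assumes diam: "\<And>x y. x \<in> X \<Longrightarrow> y \<in> X \<Longrightarrow> d x y \<le> M"
    and "size b = size c + n" "matches a b r" "matches b c s" "size a \<le> size c"
    and "set_mset a \<subseteq> X" "set_mset b \<subseteq> X" "set_mset c \<subseteq> X"
  shows "\<exists>t. matches a c t \<and> t + M * real n \<le> r + s"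
  using assms(2-)
proof (induction n arbitrary: b r s)
  case 0
  then show ?case using matches_trans[of a b r c s] by auto
next
  case (Suc n)
  have "size c < size b" using Suc.prems by simp
  then obtain z b' s' where b: "b = add_mset z b'" "matches c b' s'" "s = M + s'"
    using matches_excess[OF matches_commute[OF Suc.prems(3)]] by blast
  obtain r' where r': "r' \<le> r" "matches a b' r'"
    using matches_shrink[of a z b' r] diam Suc.prems b by auto
  have "\<exists>t. matches a c t \<and> t + M * real n \<le> r' + s'"
    using Suc.prems b r' matches_commute[OF b(2)] by (intro Suc.IH[of b']) auto
  with r' b show ?case by (force simp: distrib_left)
qed

text \<open>Pair all points of \<open>a\<close> with points of \<open>c\<close>: each point of
  \<open>c\<close> then accounts for at most \<open>M\<close>, whether paired or not.\<close>

lemma matches_bound: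
  assumes diam: "\<And>x y. x \<in> X \<Longrightarrow> y \<in> X \<Longrightarrow> d x y \<le> M"
    and "size a \<le> size c" "set_mset a \<subseteq> X" "set_mset c \<subseteq> X"
  shows "\<exists>t\<le>M * real (size c). matches a c t"
  using assms(2-)
proof (induction c arbitrary: a)
  case empty
  then show ?case by (auto intro: matches.empty)
next
  case (add y c)
  show ?case
  proof (cases a)
    case empty
    then obtain t where "t \<le> M * real (size c)" "matches {#} c t"
      using add.IH[of "{#}"] add.prems by auto
    then show ?thesis
      using matches.right[of "{#}" c t y] empty by (intro exI[of _ "M + t"]) (auto simp: distrib_left)
  next
    case (add x a')
    with add.prems obtain t where "t \<le> M * real (size c)" "matches a' c t"
      using add.IH[of a'] by auto
    moreover have "d x y \<le> M" using add add.prems by (intro diam) auto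
    ultimately show ?thesis
      using matches.pair[of a' c t x y] add
      by (intro exI[of _ "d x y + t"]) (auto simp: distrib_left)
  qed
qed

section \<open>The size-normalised distance\<close>

lemma d_Em_nonneg: "0 \<le> d_Em d M a c"
  using d_E_nonneg by (simp add: d_Em_def)

lemma d_Em_commute: "d_Em d M a c = d_Em d M c a"
  unfolding d_Em_def by (simp add: d_E_commute[of d M a c, OF commute] max.commute)

text \<open>The product form also covers the pair of empty multisets, where both sides
  vanish.\<close>

lemma d_E_eq_d_Em: "d_E d M a c = real (max (size a) (size c)) * d_Em d M a c"
proof (cases "max (size a) (size c) = 0")
  case True
  then have "a = {#}" "c = {#}" by auto
  then show ?thesis by (simp add: d_E_empty)
next
  case False
  then have "real (max (size a) (size c)) \<noteq> 0" by linarith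
  then show ?thesis unfolding d_Em_def by (metis nonzero_mult_div_cancel_left times_divide_eq_right)
qed

lemma d_Em_le_d_E: "d_Em d M a c \<le> d_E d M a c"
proof (cases "max (size a) (size c) = 0")
  case True
  then show ?thesis using d_E_nonneg[of a c] unfolding d_Em_def by auto
next
  case False
  then have "1 \<le> real (max (size a) (size c))" by linarith
  then have "1 * d_Em d M a c \<le> real (max (size a) (size c)) * d_Em d M a c"
    by (intro mult_right_mono d_Em_nonneg)
  then show ?thesis by (simp add: d_E_eq_d_Em)
qed

text \<open>If \<open>c\<close> had more than twice as many points as \<open>a\<close>, more than
  half of its points would be unmatched, and the cost per point would be at least
  \<open>M / 2\<close>.\<close>

lemma size_le_of_d_Em:
  assumes "d_Em d M a c < M / 2"
  shows "size c \<le> 2 * size a"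
proof (rule ccontr)
  assume c: "\<not> ?thesis"
  then have mx: "max (size a) (size c) = size c" and pos: "0 < real (size c)" by linarith+
  have "M * (real (size c) / 2) \<le> M * \<bar>real (size a) - real (size c)\<bar>"
    using M_pos c by (intro mult_left_mono) auto
  also have "\<dots> \<le> real (size c) * d_Em d M a c"
    using d_E_size[of a c] by (simp add: d_E_eq_d_Em mx)
  also have "\<dots> < real (size c) * (M / 2)"
    using pos assms by (intro mult_strict_left_mono)
  finally show False by (simp add: mult.commute)
qed

lemma d_E_le_d_Em:
  assumes "d_Em d M a c < M / 2"
  shows "d_E d M a c \<le> 2 * real (size a) * d_Em d M a c"
proof -
  have "real (max (size a) (size c)) \<le> 2 * real (size a)"
    using size_le_of_d_Em[OF assms] by (auto simp: max_def)
  then show ?thesis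
    unfolding d_E_eq_d_Em by (intro mult_right_mono d_Em_nonneg)
qed

text \<open>If \<open>b\<close> is no larger than \<open>c\<close>, all denominators are at most
  \<open>size c\<close> and the inequality for \<open>d_E\<close> suffices. A larger
  \<open>b\<close> inflates the denominators on the right, which is offset by the saving of
  \<open>M\<close> for each surplus point. The order of \<open>a\<close> and \<open>c\<close> is
  later removed by symmetry.\<close>

lemma d_Em_triangle:
  assumes diam: "\<And>x y. x \<in> X \<Longrightarrow> y \<in> X \<Longrightarrow> d x y \<le> M"
    and a: "set_mset a \<subseteq> X" and b: "set_mset b \<subseteq> X" and c: "set_mset c \<subseteq> X"
    and le: "size a \<le> size c"
  shows "d_Em d M a c \<le> d_Em d M a b + d_Em d M b c"
proof (cases "size c = 0")
  case True
  then have "d_Em d M a c = 0" using le by (simp add: d_Em_def)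
  then show ?thesis using d_Em_nonneg[of a b] d_Em_nonneg[of b c] by linarith
next
  case False
  define D where "D = d_E d M a b + d_E d M b c"
  let ?n = "real (size c)" and ?q = "real (size b)"
  from False have pos: "0 < ?n" by linarith
  have diam2: "d x y \<le> 2 * M" if "x \<in> X" "y \<in> X" for x y
    using diam[OF that] M_pos by linarith
  have Em: "d_Em d M a c = d_E d M a c / ?n"
    using le by (simp add: d_Em_def max_def)
  show ?thesis
  proof (cases "size b \<le> size c")
    case True
    have tri: "d_E d M a c \<le> D"
      unfolding D_def
      using matches_trans[OF matches_d_E matches_d_E a b c] d_E_le[OF diam2 _ a c] by force
    have "d_E d M a b \<le> ?n * d_Em d M a b" "d_E d M b c \<le> ?n * d_Em d M b c"
      unfolding d_E_eq_d_Em using True le by (intro mult_right_mono d_Em_nonneg; simp)+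
    with tri have "d_E d M a c \<le> ?n * (d_Em d M a b + d_Em d M b c)"
      unfolding D_def distrib_left by linarith
    then show ?thesis
      unfolding Em using pos by (simp add: divide_le_eq mult.commute)
  next
    case False
    then have q: "size b = size c + (size b - size c)" "?n < ?q" by auto
    obtain t where t: "matches a c t" "t + M * real (size b - size c) \<le> D"
      unfolding D_def
      using matches_trans_surplus[OF diam q(1) matches_d_E matches_d_E le a b c] by blast
    with d_E_le[OF diam2 t(1) a c] q have 1: "d_E d M a c + M * (?q - ?n) \<le> D"
      by (simp add: of_nat_diff)
    have "d_E d M a c \<le> M * ?n"
      using matches_bound[OF diam le a c] d_E_le[OF diam2 _ a c] by force
    then have "(?q - ?n) * d_E d M a c \<le> (?q - ?n) * (M * ?n)"
      using q by (intro mult_left_mono) auto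
    moreover have "?n * (d_E d M a c + M * (?q - ?n)) \<le> ?n * D"
      using 1 pos by (intro mult_left_mono) auto
    \<comment> \<open>Split \<open>?q\<close> as \<open>?n + (?q - ?n)\<close>: the second share of
      \<open>?q * d_E d M a c\<close> is bounded through \<open>d_E d M a c <= M * ?n\<close>, and
      both shares together give \<open>?n * (d_E d M a c + M * (?q - ?n))\<close>.\<close>
    ultimately have "?q * d_E d M a c \<le> ?n * D"
      by (simp add: algebra_simps)
    then have "d_E d M a c / ?n \<le> D / ?q"
      using pos q by (simp add: divide_simps mult.commute)
    moreover have "max (size a) (size b) = size b" "max (size b) (size c) = size b"
      using False le by auto
    ultimately show ?thesis
      unfolding Em by (simp add: d_Em_def D_def add_divide_distrib)
  qed
qed

lemma Metric_space_d_Em: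
  assumes diam: "\<And>x y. x \<in> X \<Longrightarrow> y \<in> X \<Longrightarrow> d x y \<le> M"
  shows "Metric_space (finite_multisets X) (d_Em d M)"
proof -
  have diam2: "d x y \<le> 2 * M" if "x \<in> X" "y \<in> X" for x y
    using diam[OF that] M_pos by linarith
  interpret E: Metric_space "finite_multisets X" "d_E d M"
    by (rule Metric_space_d_E[OF diam2])
  show ?thesis
  proof
    show "0 \<le> d_Em d M a c" for a c by (rule d_Em_nonneg)
    show "d_Em d M a c = d_Em d M c a" for a c by (rule d_Em_commute)
    show "d_Em d M a c = 0 \<longleftrightarrow> a = c" if "a \<in> finite_multisets X" "c \<in> finite_multisets X" for a c
    proof
      assume "d_Em d M a c = 0"
      then have "d_E d M a c = 0" by (subst d_E_eq_d_Em) simp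
      then show "a = c" using E.zero[OF that] by blast
    next
      assume "a = c"
      then have "d_E d M a c = 0" using E.zero[OF that] by blast
      then show "d_Em d M a c = 0" by (simp add: d_Em_def)
    qed
    show "d_Em d M a c \<le> d_Em d M a b + d_Em d M b c"
      if "a \<in> finite_multisets X" "b \<in> finite_multisets X" "c \<in> finite_multisets X" for a b c
    proof (cases "size a \<le> size c")
      case True
      then show ?thesis
        using that by (intro d_Em_triangle[OF diam]) (auto simp: finite_multisets_def)
    next
      case False
      then have "d_Em d M c a \<le> d_Em d M c b + d_Em d M b a"
        using that by (intro d_Em_triangle[OF diam]) (auto simp: finite_multisets_def)
      then show ?thesis
        using d_Em_commute[of a c] d_Em_commute[of a b] d_Em_commute[of b c] by linarith
    qed
  qed
qed

section \<open>Common topology and common Cauchy sequences\<close>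

lemma mtopology_d_E_eq_d_Em:
  assumes diam: "\<And>x y. x \<in> X \<Longrightarrow> y \<in> X \<Longrightarrow> d x y \<le> M"
  shows "Metric_space.mtopology (finite_multisets X) (d_E d M) =
    Metric_space.mtopology (finite_multisets X) (d_Em d M)"
proof -
  have diam2: "d x y \<le> 2 * M" if "x \<in> X" "y \<in> X" for x y
    using diam[OF that] M_pos by linarith
  interpret E: Metric_space "finite_multisets X" "d_E d M"
    by (rule Metric_space_d_E[OF diam2])
  interpret Em: Metric_space "finite_multisets X" "d_Em d M"
    by (rule Metric_space_d_Em[OF diam])
  have "openin E.mtopology U \<longleftrightarrow> openin Em.mtopology U" for U
  proof -
    have "(\<exists>r>0. E.mball a r \<subseteq> U) \<longleftrightarrow> (\<exists>r>0. Em.mball a r \<subseteq> U)" for a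
    proof
      assume "\<exists>r>0. E.mball a r \<subseteq> U"
      then obtain r where r: "r > 0" "E.mball a r \<subseteq> U" by blast
      \<comment> \<open>Within \<open>M / 2\<close> of \<open>a\<close> sizes at most double, so
        \<open>d_E\<close> is at most \<open>2 * size a\<close> times \<open>d_Em\<close>; the
        second bound divides this factor out. The \<open>+ 1\<close> keeps the denominator positive
        when \<open>a\<close> is empty.\<close>
      define \<delta> where "\<delta> = min (M / 2) (r / (2 * real (size a) + 1))"
      have "0 < \<delta>" using r M_pos by (auto simp: \<delta>_def)
      moreover have "Em.mball a \<delta> \<subseteq> E.mball a r"
      proof
        fix c assume c: "c \<in> Em.mball a \<delta>"
        then have lt: "d_Em d M a c < M / 2" "d_Em d M a c < r / (2 * real (size a) + 1)"
          by (auto simp: \<delta>_def)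
        have "d_E d M a c \<le> 2 * real (size a) * d_Em d M a c"
          by (rule d_E_le_d_Em[OF lt(1)])
        also have "\<dots> \<le> (2 * real (size a) + 1) * d_Em d M a c"
          by (intro mult_right_mono d_Em_nonneg) auto
        also have "\<dots> < r"
          using lt(2) by (simp add: pos_less_divide_eq mult.commute)
        finally show "c \<in> E.mball a r" using c by auto
      qed
      ultimately show "\<exists>r>0. Em.mball a r \<subseteq> U" using r by blast
    next
      assume "\<exists>r>0. Em.mball a r \<subseteq> U"
      then obtain r where r: "r > 0" "Em.mball a r \<subseteq> U" by blast
      moreover have "E.mball a r \<subseteq> Em.mball a r"
        using le_less_trans[OF d_Em_le_d_E] by fastforce
      ultimately show "\<exists>r>0. E.mball a r \<subseteq> U" by blast
    qed
    then show ?thesis by (simp add: E.openin_mtopology Em.openin_mtopology)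
  qed
  then show ?thesis by (simp add: topology_eq)
qed

text \<open>A tail of a \<open>d_Em\<close>-Cauchy sequence lies within \<open>M / 2\<close> of one
  of its members, so its sizes are bounded and a single factor compares the two metrics on the whole
  tail.\<close>

lemma MCauchy_d_E_iff_d_Em:
  assumes diam: "\<And>x y. x \<in> X \<Longrightarrow> y \<in> X \<Longrightarrow> d x y \<le> M"
  shows "Metric_space.MCauchy (finite_multisets X) (d_E d M) \<sigma> \<longleftrightarrow>
    Metric_space.MCauchy (finite_multisets X) (d_Em d M) \<sigma>"
proof -
  have diam2: "d x y \<le> 2 * M" if "x \<in> X" "y \<in> X" for x y
    using diam[OF that] M_pos by linarith
  interpret E: Metric_space "finite_multisets X" "d_E d M"
    by (rule Metric_space_d_E[OF diam2])
  interpret Em: Metric_space "finite_multisets X" "d_Em d M"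
    by (rule Metric_space_d_Em[OF diam])
  show ?thesis
  proof
    assume "E.MCauchy \<sigma>"
    then show "Em.MCauchy \<sigma>"
      unfolding E.MCauchy_def Em.MCauchy_def by (meson d_Em_le_d_E le_less_trans)
  next
    assume C: "Em.MCauchy \<sigma>"
    then obtain N where N: "\<And>m n. N \<le> m \<Longrightarrow> N \<le> n \<Longrightarrow> d_Em d M (\<sigma> m) (\<sigma> n) < M / 2"
      unfolding Em.MCauchy_def using M_pos by (meson half_gt_zero)
    \<comment> \<open>Sizes on the tail are at most \<open>2 * size (\<sigma> N)\<close>, and
      \<open>d_E_le_d_Em\<close> contributes another factor 2; adding 1 makes \<open>S\<close>
      positive.\<close>
    define S where "S = 4 * real (size (\<sigma> N)) + 1"
    have S: "0 < S" by (auto simp: S_def)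
    have bound: "d_E d M (\<sigma> m) (\<sigma> n) \<le> S * d_Em d M (\<sigma> m) (\<sigma> n)" if "N \<le> m" "N \<le> n" for m n
    proof -
      have "2 * real (size (\<sigma> m)) \<le> S"
        using size_le_of_d_Em[OF N[of N m]] that by (simp add: S_def)
      then show ?thesis
        using d_E_le_d_Em[OF N[OF that]] mult_right_mono[OF _ d_Em_nonneg[of "\<sigma> m" "\<sigma> n"]]
        by (meson order_trans)
    qed
    show "E.MCauchy \<sigma>"
      unfolding E.MCauchy_def
    proof (intro conjI allI impI)
      show "range \<sigma> \<subseteq> finite_multisets X" using C by (simp add: Em.MCauchy_def)
      fix \<epsilon> :: real assume "0 < \<epsilon>"
      then have "0 < \<epsilon> / S" using S by simp
      then obtain N' where N': "\<And>m n. N' \<le> m \<Longrightarrow> N' \<le> n \<Longrightarrow> d_Em d M (\<sigma> m) (\<sigma> n) < \<epsilon> / S"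
        using C unfolding Em.MCauchy_def by meson
      show "\<exists>N. \<forall>m n. N \<le> m \<longrightarrow> N \<le> n \<longrightarrow> d_E d M (\<sigma> m) (\<sigma> n) < \<epsilon>"
      proof (intro exI[of _ "max N N'"] allI impI)
        fix m n assume mn: "max N N' \<le> m" "max N N' \<le> n"
        then have "S * d_Em d M (\<sigma> m) (\<sigma> n) < \<epsilon>"
          using N'[of m n] S by (simp add: pos_less_divide_eq mult.commute)
        with bound[of m n] mn show "d_E d M (\<sigma> m) (\<sigma> n) < \<epsilon>" by simp
      qed
    qed
  qed
qed

lemma mcomplete_d_E_iff_d_Em:
  assumes diam: "\<And>x y. x \<in> X \<Longrightarrow> y \<in> X \<Longrightarrow> d x y \<le> M"
  shows "Metric_space.mcomplete (finite_multisets X) (d_E d M) \<longleftrightarrow>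
    Metric_space.mcomplete (finite_multisets X) (d_Em d M)"
proof -
  have diam2: "d x y \<le> 2 * M" if "x \<in> X" "y \<in> X" for x y
    using diam[OF that] M_pos by linarith
  interpret E: Metric_space "finite_multisets X" "d_E d M"
    by (rule Metric_space_d_E[OF diam2])
  interpret Em: Metric_space "finite_multisets X" "d_Em d M"
    by (rule Metric_space_d_Em[OF diam])
  show ?thesis
    by (simp add: E.mcomplete_def Em.mcomplete_def MCauchy_d_E_iff_d_Em[OF diam]
        mtopology_d_E_eq_d_Em[OF diam])
qed

section \<open>Completeness\<close>

lemma MCauchy_geometric:
  assumes "range f \<subseteq> X" and step: "\<And>k. d (f k) (f (Suc k)) \<le> B * (1 / 2) ^ k"
  shows "MCauchy f"
proof -
  have f: "f k \<in> X" for k using assms(1) by auto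
  have "0 \<le> B" using order_trans[OF nonneg step[of 0]] by simp
  \<comment> \<open>The right-hand side is the exact sum of the step bounds from \<open>k\<close> to
    \<open>k + m - 1\<close>; keeping the subtracted term is what carries the induction.\<close>
  have "d (f k) (f (k + m)) \<le> 2 * B * ((1 / 2) ^ k - (1 / 2) ^ (k + m))" for k m
  proof (induction m)
    case 0
    then show ?case using f by simp
  next
    case (Suc m)
    have "d (f k) (f (k + Suc m)) \<le> d (f k) (f (k + m)) + d (f (k + m)) (f (k + Suc m))"
      using f by (intro triangle)
    also have "\<dots> \<le> 2 * B * ((1 / 2) ^ k - (1 / 2) ^ (k + m)) + B * (1 / 2) ^ (k + m)"
      using Suc step[of "k + m"] by simp
    finally show ?case by (simp add: algebra_simps)
  qed
  moreover have "2 * B * ((1 / 2) ^ k - (1 / 2) ^ (k + m)) \<le> 2 * B * (1 / 2) ^ k" for k m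
    using \<open>0 \<le> B\<close> by (intro mult_left_mono) auto
  ultimately have near: "d (f k) (f (k + m)) \<le> 2 * B * (1 / 2) ^ k" for k m
    by (meson order_trans)
  show ?thesis
    unfolding MCauchy_def
  proof (intro conjI allI impI assms(1))
    fix \<epsilon> :: real assume "0 < \<epsilon>"
    \<comment> \<open>The factor 4 is twice the factor 2 of \<open>near\<close>, because two late
      terms are compared through \<open>f N\<close>.\<close>
    have "(\<lambda>k. 4 * B * (1 / 2) ^ k) \<longlonglongrightarrow> 4 * B * 0"
      by (intro tendsto_intros LIMSEQ_power_zero) auto
    then have "\<forall>\<^sub>F k in sequentially. 4 * B * (1 / 2) ^ k < \<epsilon>"
      using \<open>0 < \<epsilon>\<close> by (intro order_tendstoD(2)) auto
    then obtain N where N: "4 * B * (1 / 2) ^ N < \<epsilon>"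
      by (auto simp: eventually_sequentially)
    show "\<exists>N. \<forall>n n'. N \<le> n \<longrightarrow> N \<le> n' \<longrightarrow> d (f n) (f n') < \<epsilon>"
    proof (intro exI[of _ N] allI impI)
      fix n n' assume "N \<le> n" "N \<le> n'"
      then have "d (f N) (f n) \<le> 2 * B * (1 / 2) ^ N" "d (f N) (f n') \<le> 2 * B * (1 / 2) ^ N"
        using near[of N "n - N"] near[of N "n' - N"] by auto
      moreover have "d (f n) (f n') \<le> d (f N) (f n) + d (f N) (f n')"
        using triangle[OF f[of n] f[of N] f[of n']] by (simp add: commute[of "f n"])
      ultimately show "d (f n) (f n') < \<epsilon>" using N by linarith
    qed
  qed
qed

text \<open>A Cauchy sequence converges once a subsequence does, so a subsequence with geometrically
  small steps is enough. Its limit is the multiset of coordinatewise limits.\<close>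

lemma mcomplete_d_E:
  assumes diam: "\<And>x y. x \<in> X \<Longrightarrow> y \<in> X \<Longrightarrow> d x y \<le> 2 * M" and "mcomplete"
  shows "Metric_space.mcomplete (finite_multisets X) (d_E d M)"
proof -
  interpret E: Metric_space "finite_multisets X" "d_E d M"
    by (rule Metric_space_d_E[OF diam])
  show ?thesis
    unfolding E.mcomplete_def
  proof (intro allI impI)
    fix \<sigma> assume C: "E.MCauchy \<sigma>"
    have \<sigma>: "\<sigma> n \<in> finite_multisets X" for n using C by (auto simp: E.MCauchy_def)
    have "\<forall>k. \<exists>N. \<forall>m n. N \<le> m \<longrightarrow> N \<le> n \<longrightarrow> d_E d M (\<sigma> m) (\<sigma> n) < M * (1 / 2) ^ k"
      using C M_pos by (simp add: E.MCauchy_def)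
    then obtain N where
      N: "\<And>k m n. N k \<le> m \<Longrightarrow> N k \<le> n \<Longrightarrow> d_E d M (\<sigma> m) (\<sigma> n) < M * (1 / 2) ^ k"
      by metis
    \<comment> \<open>Summing \<open>N i + 1\<close> makes \<open>K\<close> strictly increasing
      while \<open>K k\<close> stays beyond the threshold \<open>N k\<close>.\<close>
    define K where "K = (\<lambda>k. \<Sum>i\<le>k. N i + 1)"
    have K: "strict_mono K" by (simp add: strict_mono_Suc_iff K_def)
    have NK: "N k \<le> K k" for k by (cases k) (auto simp: K_def)
    define \<tau> where "\<tau> = \<sigma> \<circ> K"
    have step: "d_E d M (\<tau> k) (\<tau> (Suc k)) < M * (1 / 2) ^ k" for k
      using NK[of k] strict_monoD[OF K, of k "Suc k"] by (auto simp: \<tau>_def intro!: N)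
    have size_Suc: "size (\<tau> (Suc k)) = size (\<tau> k)" for k
    proof -
      \<comment> \<open>A change of size costs at least \<open>M\<close>, whereas every step is
        shorter than \<open>M\<close>.\<close>
      have "M * (1 / 2) ^ k \<le> M * 1"
        using M_pos by (intro mult_left_mono power_le_one) auto
      then have "M * \<bar>real (size (\<tau> k)) - real (size (\<tau> (Suc k)))\<bar> < M * 1"
        using d_E_size[of "\<tau> k" "\<tau> (Suc k)"] step[of k] by linarith
      then have "\<bar>real (size (\<tau> k)) - real (size (\<tau> (Suc k)))\<bar> < 1"
        using M_pos by (simp only: mult_less_cancel_left_pos)
      then show ?thesis by linarith
    qed
    define n where "n = size (\<tau> 0)"
    have size: "size (\<tau> k) = n" for k by (induction k) (auto simp: n_def size_Suc)
    \<comment> \<open>Dependent choice aligns each enumeration with its predecessor by an optimal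
      matching. A nonnegative summand is at most the whole sum, so every coordinate inherits the
      step bound.\<close>
    have "\<exists>L. \<forall>k. mset (L k) = \<tau> k \<and> (\<forall>j<n. d (L k ! j) (L (Suc k) ! j) \<le> M * (1 / 2) ^ k)"
    proof (rule dependent_nat_choice)
      show "\<exists>as. mset as = \<tau> 0" by (rule ex_mset)
      fix as k assume as: "mset as = \<tau> k"
      then have l: "length as = n" using size by (metis size_mset)
      obtain cs where cs: "mset cs = \<tau> (Suc k)"
        "d_E d M (\<tau> k) (\<tau> (Suc k)) = (\<Sum>j<n. d (as ! j) (cs ! j))"
        using d_E_enumeration[OF as, of "\<tau> (Suc k)"] size l by auto
      have "d (as ! j) (cs ! j) \<le> M * (1 / 2) ^ k" if "j < n" for j
        using member_le_sum[of j "{..<n}" "\<lambda>j. d (as ! j) (cs ! j)"] that step[of k] cs(2) by simp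
      with cs(1) show "\<exists>cs. mset cs = \<tau> (Suc k) \<and> (\<forall>j<n. d (as ! j) (cs ! j) \<le> M * (1 / 2) ^ k)"
        by blast
    qed
    then obtain L where L: "\<And>k. mset (L k) = \<tau> k"
      and Lstep: "\<And>k j. j < n \<Longrightarrow> d (L k ! j) (L (Suc k) ! j) \<le> M * (1 / 2) ^ k" by blast
    have len: "length (L k) = n" for k using L size by (metis size_mset)
    have LX: "L k ! j \<in> X" if "j < n" for j k
    proof -
      have "L k ! j \<in># \<tau> k" using that len[of k] by (simp flip: L)
      then show ?thesis using \<sigma>[of "K k"] by (auto simp: finite_multisets_def \<tau>_def)
    qed
    have "\<exists>l. limitin mtopology (\<lambda>k. L k ! j) l sequentially" if "j < n" for j
    proof -
      have "MCauchy (\<lambda>k. L k ! j)"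
        using that LX Lstep by (intro MCauchy_geometric[of _ M]) auto
      then show ?thesis using \<open>mcomplete\<close> by (simp add: mcomplete_def)
    qed
    then obtain l where l: "\<And>j. j < n \<Longrightarrow> limitin mtopology (\<lambda>k. L k ! j) (l j) sequentially"
      by metis
    define c where "c = mset (map l [0..<n])"
    have c: "c \<in> finite_multisets X"
      using l by (auto simp: c_def finite_multisets_def limitin_metric)
    have "(\<lambda>k. \<Sum>j<n. d (L k ! j) (l j)) \<longlonglongrightarrow> (\<Sum>j<n. 0)"
      using l by (intro tendsto_sum) (simp add: limitin_metric_dist_null)
    then have lim: "(\<lambda>k. \<Sum>j<n. d (L k ! j) (l j)) \<longlonglongrightarrow> 0" by simp
    \<comment> \<open>Pairing each \<open>L k ! j\<close> with the limit of its coordinate is one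
      partial matching, so its cost bounds \<open>d_E\<close>.\<close>
    have upper: "d_E d M (\<tau> k) c \<le> (\<Sum>j<n. d (L k ! j) (l j))" for k
    proof (rule d_E_le[OF diam])
      show "matches (\<tau> k) c (\<Sum>j<n. d (L k ! j) (l j))"
        using matches_lists[of "L k" "map l [0..<n]"] by (simp add: len L c_def del: mset_map)
    qed (use c \<sigma> in \<open>auto simp: finite_multisets_def \<tau>_def\<close>)
    have "(\<lambda>k. d_E d M (\<tau> k) c) \<longlonglongrightarrow> 0"
      by (rule tendsto_sandwich[OF always_eventually always_eventually tendsto_const lim])
        (simp_all only: d_E_nonneg upper simp_thms)
    then have "limitin E.mtopology (\<sigma> \<circ> K) c sequentially"
      using c \<sigma> by (simp add: E.limitin_metric_dist_null \<tau>_def)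
    then show "\<exists>c. limitin E.mtopology \<sigma> c sequentially"
      using E.MCauchy_convergent_subsequence[OF C K] by blast
  qed
qed

lemma d_E_singletons: "d_E d M {#x#} {#y#} = d x y"
  by (subst d_E_eq_list_dist[of "[x]" _ "[y]"]) (auto simp: list_dist_def lessThan_Suc)

lemma mcomplete_of_d_E:
  assumes diam: "\<And>x y. x \<in> X \<Longrightarrow> y \<in> X \<Longrightarrow> d x y \<le> 2 * M"
    and compl: "Metric_space.mcomplete (finite_multisets X) (d_E d M)"
  shows "mcomplete"
  unfolding mcomplete_def
proof (intro allI impI)
  interpret E: Metric_space "finite_multisets X" "d_E d M"
    by (rule Metric_space_d_E[OF diam])
  fix \<sigma> assume C: "MCauchy \<sigma>"
  then have "E.MCauchy (\<lambda>n. {#\<sigma> n#})"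
    unfolding E.MCauchy_def MCauchy_def by (auto simp: d_E_singletons finite_multisets_def)
  then obtain e where e: "limitin E.mtopology (\<lambda>n. {#\<sigma> n#}) e sequentially"
    using compl by (auto simp: E.mcomplete_def)
  \<comment> \<open>The radius \<open>M\<close> is chosen because a multiset of another size is at
    distance at least \<open>M\<close> from a singleton.\<close>
  then obtain N where "d_E d M {#\<sigma> N#} e < M"
    using M_pos by (auto simp: E.limit_metric_sequentially)
  with d_E_size[of "{#\<sigma> N#}" e] have "M * \<bar>1 - real (size e)\<bar> < M * 1" by simp
  then have "\<bar>1 - real (size e)\<bar> < 1"
    using M_pos by (simp only: mult_less_cancel_left_pos)
  then have "size e = 1" by linarith
  then obtain x where "e = {#x#}" using size_1_singleton_mset by blast
  with e have "limitin mtopology \<sigma> x sequentially"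
    unfolding E.limit_metric_sequentially limit_metric_sequentially
    by (simp add: d_E_singletons finite_multisets_def)
  then show "\<exists>x. limitin mtopology \<sigma> x sequentially" ..
qed

end

section \<open>Bounds on \<open>\<theta>\<close> as diameter bounds, and assembly of the
  claims\<close>

theorem proposition6:
  fixes X :: "'a set" and d :: "'a \<Rightarrow> 'a \<Rightarrow> real" and M \<theta> :: real
  assumes "Metric_space X d"
    and "Metric_space.mbounded X d X"
    and "\<exists>x\<in>X. \<exists>y\<in>X. x \<noteq> y"
    and "M > 0"
    and "\<theta> = sup_dist X d / M"
  shows "(\<theta> \<le> 1 \<longrightarrow>
            Metric_space (finite_multisets X) (d_E d M) \<and>
            Metric_space (finite_multisets X) (d_Em d M) \<and>
            Metric_space.mtopology (finite_multisets X) (d_E d M) =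
            Metric_space.mtopology (finite_multisets X) (d_Em d M)) \<and>
         (\<theta> \<le> 2 \<longrightarrow>
            Metric_space (finite_multisets X) (d_E d M) \<and>
            (Metric_space.mcomplete (finite_multisets X) (d_E d M) \<longleftrightarrow>
             Metric_space.mcomplete X d)) \<and>
         (\<theta> \<le> 1 \<longrightarrow>
            Metric_space (finite_multisets X) (d_Em d M) \<and>
            (Metric_space.mcomplete (finite_multisets X) (d_Em d M) \<longleftrightarrow>
             Metric_space.mcomplete X d))"
proof -
  interpret matching_cost X d M
    using assms(1,4) by (simp add: matching_cost_def matching_cost_axioms_def)
  obtain B where B: "\<And>x y. x \<in> X \<Longrightarrow> y \<in> X \<Longrightarrow> d x y \<le> B"
    using assms(2) by (auto simp: mbounded_alt)
  \<comment> \<open>Boundedness of \<open>X\<close> bounds the set of distances above, which turns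
    the real supremum into an upper bound.\<close>
  have sup: "d x y \<le> sup_dist X d" if "x \<in> X" "y \<in> X" for x y
  proof -
    have "bdd_above ((\<lambda>(x, y). d x y) ` (X \<times> X))"
      using B by (intro bdd_aboveI[of _ B]) auto
    then have "(\<lambda>(x, y). d x y) (x, y) \<le> sup_dist X d"
      unfolding sup_dist_def using that by (intro cSUP_upper) auto
    then show ?thesis by simp
  qed
  \<comment> \<open>The parameter \<open>t\<close> serves both thresholds: \<open>t = 1\<close> for
    \<open>d_Em\<close> and \<open>t = 2\<close> for \<open>d_E\<close>.\<close>
  have diam: "d x y \<le> t * M" if "\<theta> \<le> t" "x \<in> X" "y \<in> X" for t x y
  proof -
    have "sup_dist X d \<le> t * M" using that(1) assms(4,5) by (simp add: divide_le_eq)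
    with sup[OF that(2,3)] show ?thesis by linarith
  qed
  have complete: "Metric_space.mcomplete (finite_multisets X) (d_E d M) \<longleftrightarrow> mcomplete" if "\<theta> \<le> 2"
    using mcomplete_d_E[OF diam[OF that]] mcomplete_of_d_E[OF diam[OF that]] by blast
  have diam1: "d x y \<le> M" if "\<theta> \<le> 1" "x \<in> X" "y \<in> X" for x y
    using diam[OF that] by simp
  show ?thesis
  proof (intro conjI impI)
    assume \<theta>: "\<theta> \<le> 1"
    then have \<theta>2: "\<theta> \<le> 2" by simp
    show "Metric_space (finite_multisets X) (d_E d M)"
      by (rule Metric_space_d_E[OF diam[OF \<theta>2]])
    show "Metric_space (finite_multisets X) (d_Em d M)"
      by (rule Metric_space_d_Em[OF diam1[OF \<theta>]])
    then show "Metric_space (finite_multisets X) (d_Em d M)" .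
    show "Metric_space.mtopology (finite_multisets X) (d_E d M) =
        Metric_space.mtopology (finite_multisets X) (d_Em d M)"
      by (rule mtopology_d_E_eq_d_Em[OF diam1[OF \<theta>]])
    show "Metric_space.mcomplete (finite_multisets X) (d_Em d M) \<longleftrightarrow> mcomplete"
      using complete[OF \<theta>2] mcomplete_d_E_iff_d_Em[OF diam1[OF \<theta>]] by simp
  next
    assume \<theta>: "\<theta> \<le> 2"
    show "Metric_space (finite_multisets X) (d_E d M)"
      by (rule Metric_space_d_E[OF diam[OF \<theta>]])
    show "Metric_space.mcomplete (finite_multisets X) (d_E d M) \<longleftrightarrow> mcomplete"
      by (rule complete[OF \<theta>])
  qed
qed

end
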